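(* The bite at $(2,2)$ is a winning opening move of the $a\times b$ bar if and only if $a=b$. Consequently the number of winning opening moves of a square bar is odd; in particular no square bar has exactly two.
   Context: Chomp on the $a\times b$ bar: the board consists of the cells $(r,c)$ with $1\le r\le a$, $1\le c\le b$ (rows indexed downward). Two players alternate. A move (bite) at a remaining cell $(i,j)$ removes every remaining cell $(r,c)$ with $r\ge i$ and $c\ge j$. The player forced to take the poisoned cell $(1,1)$ loses. A position is a $P$-position if the player to move loses under optimal play. An opening move (a bite of the full bar) is winning if it leaves a $P$-position for the opponent. A square bar is one with $a=b$.
   Formalization: The 1×1 bar is excluded from the "if and only if" and from the oddness claim, since it has no cell (2,2) and has zero winning opening moves; "no square bar has exactly two" still covers it. *)

theory Defs
  imports Main
begin

text \<open>Chomp. Cells are pairs (row, column), both indexed from 1, and a position is the set of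
  remaining cells.\<close>

type_synonym cell = "nat \<times> nat"
type_synonym position = "cell set"

definition bar :: "nat \<Rightarrow> nat \<Rightarrow> position" where
  "bar a b = {(r, c). 1 \<le> r \<and> r \<le> a \<and> 1 \<le> c \<and> c \<le> b}"

definition bite :: "cell \<Rightarrow> position \<Rightarrow> position" where
  "bite p S = {q \<in> S. \<not> (fst p \<le> fst q \<and> snd p \<le> snd q)}"

abbreviation poison :: cell where
  "poison \<equiv> (1, 1)"

text \<open>Outcome under optimal play, seen from the player to move. The game is over once the
  poisoned cell is gone: the opponent has just taken it, so the player to move has won. The least
  fixed point is harmless because play on a finite board terminates: on finite positions exactly
  one of the two predicates holds, as shown below.\<close>

inductive P_position :: "position \<Rightarrow> bool" and N_position :: "position \<Rightarrow> bool" where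
  over: "poison \<notin> S \<Longrightarrow> N_position S"
| win: "poison \<in> S \<Longrightarrow> p \<in> S \<Longrightarrow> P_position (bite p S) \<Longrightarrow> N_position S"
| lose: "poison \<in> S \<Longrightarrow> (\<And>p. p \<in> S \<Longrightarrow> N_position (bite p S)) \<Longrightarrow> P_position S"

text \<open>A move must be a bite at a cell of the board, so for instance (2,2) is not an opening move
  of a bar with a single row.\<close>

definition winning_opening_move :: "nat \<Rightarrow> nat \<Rightarrow> cell \<Rightarrow> bool" where
  "winning_opening_move a b p \<longleftrightarrow> p \<in> bar a b \<and> P_position (bite p (bar a b))"

lemma P_N_exclusive:
  "P_position S \<Longrightarrow> \<not> N_position S" and "N_position S \<Longrightarrow> \<not> P_position S"
proof (induction rule: P_position_N_position.inducts)
  case (over S)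
  show ?case by (subst P_position.simps) (use over in blast)
next
  case (win S p)
  show ?case by (subst P_position.simps) (use win in blast)
next
  case (lose S)
  show ?case by (subst N_position.simps) (use lose in blast)
qed

lemma P_or_N:
  assumes "finite S"
  shows "P_position S \<or> N_position S"
  using assms
proof (induction S rule: finite_psubset_induct)
  case (psubset S)
  have "bite p S \<subset> S" if "p \<in> S" for p
  proof -
    have "p \<notin> bite p S" by (simp add: bite_def)
    moreover have "bite p S \<subseteq> S" unfolding bite_def by blast
    ultimately show ?thesis using that by blast
  qed
  then have IH: "P_position (bite p S) \<or> N_position (bite p S)" if "p \<in> S" for p
    using psubset.IH[of "bite p S"] that by simp
  show ?case
  proof (cases "poison \<in> S \<and> (\<forall>p\<in>S. N_position (bite p S))")
    case True
    then have "P_position S" by (simp add: lose)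
    then show ?thesis ..
  next
    case False
    show ?thesis
    proof (cases "poison \<in> S")
      case True
      with False obtain p where p: "p \<in> S" "\<not> N_position (bite p S)" by auto
      with IH[of p] have "P_position (bite p S)" by simp
      then show ?thesis using win[OF True p(1)] by simp
    next
      case False
      then show ?thesis using over[of S] by simp
    qed
  qed
qed

end

theory Submission
  imports Defs
begin

text \<open>
  After the bite at (2,2) an L-shape remains: the first column, with \<open>a\<close> cells, and the first row,
  with \<open>b\<close> cells, sharing the poisoned corner. It behaves like Nim with two heaps of sizes
  \<open>a - 1\<close> and \<open>b - 1\<close>: the player to move loses exactly if the arms are equal, since any safe bite
  shortens one arm and the opponent answers by trimming the other to the same length
  (\<open>L_shape_P_iff\<close>).

  For the parity, on a square bar of side at least 2, reflection in the diagonal maps winning openings to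
  winning openings (\<open>P_position_swap\<close>), so those off the diagonal pair up. On the diagonal only
  (2,2) wins (\<open>winning_diagonal_iff\<close>): biting at (1,1) loses at once, and a bite further out
  leaves the cell (2,2) for the opponent, who bites there and reaches the balanced L-shape. On the
  single-cell bar there is no winning opening at all.
\<close>

text \<open>The first column of height \<open>a\<close> together with the first row of width \<open>b\<close>; both lengths
  include the poisoned corner.\<close>

definition L_shape :: "nat \<Rightarrow> nat \<Rightarrow> position" where
  "L_shape a b = {(r, c) \<in> bar a b. r = 1 \<or> c = 1}"

lemma bite_2_2_bar: "bite (2, 2) (bar a b) = L_shape a b"
  by (auto simp: bite_def bar_def L_shape_def)

lemma bite_column_L_shape:
  assumes "2 \<le> r" "r \<le> a"
  shows "bite (r, 1) (L_shape a b) = L_shape (r - 1) b"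
  using assms by (auto simp: bite_def bar_def L_shape_def)

lemma bite_row_L_shape:
  assumes "2 \<le> c" "c \<le> b"
  shows "bite (1, c) (L_shape a b) = L_shape a (c - 1)"
  using assms by (auto simp: bite_def bar_def L_shape_def)

lemma N_position_bite_poison: "N_position (bite poison S)"
  by (rule over) (simp add: bite_def)

text \<open>Trimming the longer arm to the length of the shorter one.\<close>

lemma N_position_L_shape_unequal:
  assumes "1 \<le> a" "1 \<le> b" "a \<noteq> b" and P: "P_position (L_shape (min a b) (min a b))"
  shows "N_position (L_shape a b)"
proof (cases "a < b")
  case True
  then have "bite (1, a + 1) (L_shape a b) = L_shape a a"
    using assms by (subst bite_row_L_shape) auto
  with True P have "P_position (bite (1, a + 1) (L_shape a b))"
    by (simp add: min_def)
  then show ?thesis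
    by (rule win[rotated 2]) (use assms True in \<open>auto simp: L_shape_def bar_def\<close>)
next
  case False
  then have "bite (b + 1, 1) (L_shape a b) = L_shape b b"
    using assms by (subst bite_column_L_shape) auto
  with False P have "P_position (bite (b + 1, 1) (L_shape a b))"
    by (simp add: min.absorb2)
  then show ?thesis
    by (rule win[rotated 2]) (use assms False in \<open>auto simp: L_shape_def bar_def\<close>)
qed

lemma P_position_L_shape_equal:
  assumes "1 \<le> n"
  shows "P_position (L_shape n n)"
  using assms
proof (induction n rule: less_induct)
  case (less n)
  show ?case
  proof (rule lose)
    show "poison \<in> L_shape n n"
      using less.prems by (simp add: L_shape_def bar_def)
  next
    fix p assume "p \<in> L_shape n n"
    then consider "p = poison"
      | r where "p = (r, 1)" "2 \<le> r" "r \<le> n"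
      | c where "p = (1, c)" "2 \<le> c" "c \<le> n"
      by (cases p) (fastforce simp: L_shape_def bar_def)
    then show "N_position (bite p (L_shape n n))"
    proof cases
      case 1
      then show ?thesis by (simp only: N_position_bite_poison)
    next
      case (2 r)
      then have "N_position (L_shape (r - 1) n)"
        by (intro N_position_L_shape_unequal) (auto intro!: less.IH simp: min_def)
      then show ?thesis
        using 2 by (simp only: bite_column_L_shape)
    next
      case (3 c)
      then have "N_position (L_shape n (c - 1))"
        by (intro N_position_L_shape_unequal) (auto intro!: less.IH simp: min_def)
      then show ?thesis
        using 3 by (simp only: bite_row_L_shape)
    qed
  qed
qed

lemma L_shape_P_iff:
  assumes "1 \<le> a" "1 \<le> b"
  shows "P_position (L_shape a b) \<longleftrightarrow> a = b"
proof (cases "a = b")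
  case True
  then show ?thesis using P_position_L_shape_equal[OF assms(1)] by simp
next
  case False
  then have "N_position (L_shape a b)"
    using assms by (intro N_position_L_shape_unequal P_position_L_shape_equal) auto
  then show ?thesis using False P_N_exclusive by blast
qed

lemma winning_2_2_iff:
  assumes "1 \<le> a" "1 \<le> b" "\<not> (a = 1 \<and> b = 1)"
  shows "winning_opening_move a b (2, 2) \<longleftrightarrow> a = b"
  unfolding winning_opening_move_def bite_2_2_bar L_shape_P_iff[OF assms(1,2)]
  using assms by (auto simp: bar_def)

text \<open>The outcome of a position is invariant under reflection in the diagonal.\<close>

lemma bite_swap: "bite (prod.swap p) (prod.swap ` S) = prod.swap ` bite p S"
  by (auto simp: bite_def)

lemma P_position_swap: "P_position S \<Longrightarrow> P_position (prod.swap ` S)"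
  and N_position_swap: "N_position S \<Longrightarrow> N_position (prod.swap ` S)"
proof (induction rule: P_position_N_position.inducts)
  case (over S)
  then show ?case by (intro P_position_N_position.over) auto
next
  case (win S p)
  show ?case
  proof (rule P_position_N_position.win)
    show "poison \<in> prod.swap ` S" using win.hyps by force
    show "prod.swap p \<in> prod.swap ` S" using win.hyps by blast
    show "P_position (bite (prod.swap p) (prod.swap ` S))"
      using win.IH by (simp only: bite_swap)
  qed
next
  case (lose S)
  show ?case
  proof (rule P_position_N_position.lose)
    show "poison \<in> prod.swap ` S" using lose.hyps by force
    show "N_position (bite q (prod.swap ` S))" if "q \<in> prod.swap ` S" for q
      using that lose.IH by (auto simp only: bite_swap)
  qed
qed

lemma swap_bar: "prod.swap ` bar a b = bar b a"
  by (auto simp: bar_def image_iff)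

lemma winning_opening_move_swap:
  assumes "winning_opening_move a b p"
  shows "winning_opening_move b a (prod.swap p)"
proof -
  have "prod.swap p \<in> bar b a"
    using assms swap_bar[of a b] by (auto simp: winning_opening_move_def)
  moreover have "P_position (bite (prod.swap p) (bar b a))"
    using assms P_position_swap[of "bite p (bar a b)"] bite_swap[of p "bar a b"]
    by (simp add: winning_opening_move_def swap_bar)
  ultimately show ?thesis by (simp add: winning_opening_move_def)
qed

lemma winning_diagonal_iff:
  assumes "2 \<le> n"
  shows "winning_opening_move n n (k, k) \<longleftrightarrow> k = 2"
proof
  assume W: "winning_opening_move n n (k, k)"
  then have k: "1 \<le> k" and P: "P_position (bite (k, k) (bar n n))"
    by (auto simp: winning_opening_move_def bar_def)
  have notN: "\<not> N_position (bite (k, k) (bar n n))"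
    using P by (rule P_N_exclusive)
  show "k = 2"
  proof (rule ccontr)
    assume "k \<noteq> 2"
    with k consider "k = 1" | "3 \<le> k" by linarith
    then show False
    proof cases
      case 1
      then show False using notN N_position_bite_poison by simp
    next
      case 2
      \<comment> \<open>The bite at (2,2) removes whatever the bite at \<open>(k,k)\<close> would have removed.\<close>
      have "bite (2, 2) (bite (k, k) (bar n n)) = L_shape n n"
        using 2 by (auto simp: bite_def bar_def L_shape_def)
      then have "P_position (bite (2, 2) (bite (k, k) (bar n n)))"
        using assms by (simp add: P_position_L_shape_equal)
      then have "N_position (bite (k, k) (bar n n))"
        by (rule win[rotated 2]) (use assms 2 in \<open>auto simp: bite_def bar_def\<close>)
      with notN show False by contradiction
    qed
  qed
next
  assume "k = 2"
  then show "winning_opening_move n n (k, k)"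
    using winning_2_2_iff[of n n] assms by simp
qed

lemma finite_bar: "finite (bar a b)"
  by (rule finite_subset[of _ "{1..a} \<times> {1..b}"]) (auto simp: bar_def)

lemma odd_card_winning_square:
  assumes "2 \<le> n"
  shows "odd (card {p. winning_opening_move n n p})"
proof -
  define W where "W = {p. winning_opening_move n n p}"
  define U where "U = {p \<in> W. fst p < snd p}"
  define D where "D = {p \<in> W. snd p < fst p}"
  have finW: "finite W"
    by (rule finite_subset[OF _ finite_bar[of n n]]) (auto simp: W_def winning_opening_move_def)
  have swapW: "prod.swap p \<in> W" if "p \<in> W" for p
    using that winning_opening_move_swap by (simp add: W_def)
  have "D = prod.swap ` U"
  proof
    show "prod.swap ` U \<subseteq> D"
      using swapW by (auto simp: U_def D_def)
    show "D \<subseteq> prod.swap ` U"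
    proof
      fix p assume "p \<in> D"
      then have "prod.swap p \<in> U" using swapW by (auto simp: U_def D_def)
      then show "p \<in> prod.swap ` U" by (rule rev_image_eqI) simp
    qed
  qed
  then have "card D = card U"
    by (simp add: card_image)
  have "W = insert (2, 2) (U \<union> D)"
  proof (rule set_eqI)
    fix p :: cell
    obtain r c where p: "p = (r, c)" by (cases p)
    show "p \<in> W \<longleftrightarrow> p \<in> insert (2, 2) (U \<union> D)"
      using winning_diagonal_iff[OF assms, of r] winning_diagonal_iff[OF assms, of 2]
      by (cases r c rule: linorder_cases) (auto simp: p W_def U_def D_def)
  qed
  moreover have "card (insert (2, 2) (U \<union> D)) = Suc (card U + card D)"
  proof -
    have "finite U" "finite D" "U \<inter> D = {}" "(2, 2) \<notin> U \<union> D"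
      using finW by (auto simp: U_def D_def)
    then show ?thesis by (simp add: card_Un_disjoint)
  qed
  ultimately have "odd (card W)"
    using \<open>card D = card U\<close> by simp
  then show ?thesis by (simp add: W_def)
qed

lemma no_winning_opening_1_1: "\<not> winning_opening_move 1 1 p"
proof
  assume W: "winning_opening_move 1 1 p"
  then have "p = poison" by (auto simp: winning_opening_move_def bar_def)
  with W have "P_position (bite poison (bar 1 1))" by (simp add: winning_opening_move_def)
  then show False using N_position_bite_poison P_N_exclusive by blast
qed

theorem theorem4p4:
  "(\<forall>a b. 1 \<le> a \<and> 1 \<le> b \<and> \<not> (a = 1 \<and> b = 1) \<longrightarrow>
      (winning_opening_move a b (2, 2) \<longleftrightarrow> a = b)) \<and>
   (\<forall>n\<ge>2. odd (card {p. winning_opening_move n n p})) \<and>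
   (\<forall>n\<ge>1. card {p. winning_opening_move n n p} \<noteq> 2)"
proof (intro conjI allI impI)
  fix a b :: nat
  assume "1 \<le> a \<and> 1 \<le> b \<and> \<not> (a = 1 \<and> b = 1)"
  then show "winning_opening_move a b (2, 2) \<longleftrightarrow> a = b"
    by (intro winning_2_2_iff) auto
next
  fix n :: nat
  assume "2 \<le> n"
  then show "odd (card {p. winning_opening_move n n p})"
    by (rule odd_card_winning_square)
next
  fix n :: nat
  assume "1 \<le> n"
  then consider "n = 1" | "2 \<le> n" by linarith
  then show "card {p. winning_opening_move n n p} \<noteq> 2"
  proof cases
    case 1
    then show ?thesis using no_winning_opening_1_1 by simp
  next
    case 2
    then have "odd (card {p. winning_opening_move n n p})"
      by (rule odd_card_winning_square)
    then show ?thesis by auto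
  qed
qed

end
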